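(* Let $\mathcal{C}$ be a CMV matrix, $\Omega$ a tridiagonal matrix and $n\ge0$ an integer. The following are equivalent: (i) $(\mathrm{ad}\,\mathcal{C})^{n+1}\Omega=0$; (ii) $(\mathrm{ad}\,\mathcal{C})^{n}\Omega=a\,\mathcal{C}^n$ for some $a\in\mathbb{C}$; (iii) $(\mathrm{ad}_n\,\mathcal{C})\Omega=a I$ for some $a\in\mathbb{C}$, where $I$ is the infinite identity matrix.
   Context: All matrices are complex and infinite, with rows and columns indexed by $0,1,2,\dots$; $A^\dagger$ is the conjugate transpose. A band matrix is one with only finitely many nonzero diagonals. Given a sequence $(\alpha_n)_{n\ge0}$ (the Verblunsky coefficients) in the open unit disk, put $\rho_n=\sqrt{1-|\alpha_n|^2}$, $\Theta_n=\begin{pmatrix}\overline{\alpha}_n&\rho_n\\ \rho_n&-\alpha_n\end{pmatrix}$, $\mathcal{L}=\Theta_0\oplus\Theta_2\oplus\Theta_4\oplus\cdots$, $\mathcal{M}=(1)\oplus\Theta_1\oplus\Theta_3\oplus\cdots$. The CMV matrix is $\mathcal{C}=\mathcal{L}\mathcal{M}$ (a five-diagonal unitary matrix; $\mathcal{L},\mathcal{M}$ are symmetric and unitary). For a band matrix $\Omega$, $(\mathrm{ad}\,\mathcal{C})\Omega=\mathcal{C}\Omega-\Omega\mathcal{C}$, $(\mathrm{ad}\,\mathcal{C})^n$ is its $n$-th iterate, and $$(\mathrm{ad}_n\,\mathcal{C})\Omega:=\begin{cases}(\mathcal{C}^\dagger)^m\,\big((\mathrm{ad}\,\mathcal{C})^n\Omega\big)\,(\mathcal{C}^\dagger)^m,&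 n=2m,\\ \mathcal{L}^\dagger(\mathcal{C}^\dagger)^m\,\big((\mathrm{ad}\,\mathcal{C})^n\Omega\big)\,(\mathcal{C}^\dagger)^m\mathcal{M}^\dagger,& n=2m+1.\end{cases}$$ *)

theory Defs
  imports Complex_Main
begin

type_synonym infmat = "nat \<Rightarrow> nat \<Rightarrow> complex"

(* The entries of a product are in general series. In every product formed below at least one
   factor is a band matrix, so all but finitely many terms vanish and suminf is a finite sum. *)
definition mmult :: "infmat \<Rightarrow> infmat \<Rightarrow> infmat"  (infixl "\<odot>" 70) where
  "A \<odot> B = (\<lambda>i j. \<Sum>k. A i k * B k j)"

definition mminus :: "infmat \<Rightarrow> infmat \<Rightarrow> infmat" where
  "mminus A B = (\<lambda>i j. A i j - B i j)"

definition mscale :: "complex \<Rightarrow> infmat \<Rightarrow> infmat" where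
  "mscale a A = (\<lambda>i j. a * A i j)"

definition mzero :: infmat where
  "mzero = (\<lambda>i j. 0)"

definition mone :: infmat where
  "mone = (\<lambda>i j. if i = j then 1 else 0)"

primrec mpow :: "infmat \<Rightarrow> nat \<Rightarrow> infmat" where
  "mpow A 0 = mone"
| "mpow A (Suc n) = A \<odot> mpow A n"

definition adjoint_mat :: "infmat \<Rightarrow> infmat" where
  "adjoint_mat A = (\<lambda>i j. cnj (A j i))"

definition tridiagonal :: "infmat \<Rightarrow> bool" where
  "tridiagonal A \<longleftrightarrow> (\<forall>i j. 1 < \<bar>int i - int j\<bar> \<longrightarrow> A i j = 0)"

definition verblunsky :: "(nat \<Rightarrow> complex) \<Rightarrow> bool" where
  "verblunsky \<alpha> \<longleftrightarrow> (\<forall>n. cmod (\<alpha> n) < 1)"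

definition rho :: "(nat \<Rightarrow> complex) \<Rightarrow> nat \<Rightarrow> real" where
  "rho \<alpha> n = sqrt (1 - (cmod (\<alpha> n))\<^sup>2)"

(* A 2 x 2 matrix; only the row and column indices 0 and 1 are ever used. *)
definition Theta :: "(nat \<Rightarrow> complex) \<Rightarrow> nat \<Rightarrow> nat \<Rightarrow> nat \<Rightarrow> complex" where
  "Theta \<alpha> n r s =
     (if r = 0 \<and> s = 0 then cnj (\<alpha> n)
      else if r = 1 \<and> s = 1 then - \<alpha> n
      else complex_of_real (rho \<alpha> n))"

(* The k-th diagonal block Theta_(2k) occupies the rows and columns 2k, 2k+1. *)
definition cmv_L :: "(nat \<Rightarrow> complex) \<Rightarrow> infmat" where
  "cmv_L \<alpha> = (\<lambda>i j.
     if i div 2 = j div 2 then Theta \<alpha> (2 * (i div 2)) (i mod 2) (j mod 2) else 0)"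

(* After the entry 1 at position (0,0), the diagonal block Theta_(2k+1) occupies the rows and
   columns 2k+1, 2k+2. *)
definition cmv_M :: "(nat \<Rightarrow> complex) \<Rightarrow> infmat" where
  "cmv_M \<alpha> = (\<lambda>i j.
     if i = 0 \<or> j = 0 then (if i = j then 1 else 0)
     else if (i - 1) div 2 = (j - 1) div 2
       then Theta \<alpha> (2 * ((i - 1) div 2) + 1) ((i - 1) mod 2) ((j - 1) mod 2)
     else 0)"

definition CMV :: "(nat \<Rightarrow> complex) \<Rightarrow> infmat" where
  "CMV \<alpha> = cmv_L \<alpha> \<odot> cmv_M \<alpha>"

definition ad :: "infmat \<Rightarrow> infmat \<Rightarrow> infmat" where
  "ad A X = mminus (A \<odot> X) (X \<odot> A)"

(* The normalized iterate written ad_n C in the literature, as opposed to the plain iterate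
   ad (CMV \<alpha>) ^^ n. It depends on the factors L and M, hence the argument \<alpha>. *)
definition ad_sub :: "nat \<Rightarrow> (nat \<Rightarrow> complex) \<Rightarrow> infmat \<Rightarrow> infmat" where
  "ad_sub n \<alpha> X =
     (let m = n div 2;
          P = mpow (adjoint_mat (CMV \<alpha>)) m;
          Y = (ad (CMV \<alpha>) ^^ n) X
      in if even n then P \<odot> Y \<odot> P
         else adjoint_mat (cmv_L \<alpha>) \<odot> P \<odot> Y \<odot> P \<odot> adjoint_mat (cmv_M \<alpha>))"

end

theory Submission
  imports Defs "HOL-Library.Function_Algebras"
begin

text \<open>
  The equivalence of the last two conditions is unitarity: \<^term>\<open>ad_sub n \<alpha> \<Omega>\<close> arises from the
  plain iterate by multiplying on either side with unitary factors whose inverses, put together,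
  give the power \<open>C ^ n\<close> of the CMV matrix \<open>C\<close> (\<open>ad_sub_scalar_iff\<close>). That a multiple of \<open>C ^ n\<close> is
  killed by one more commutator is clear, since \<open>C\<close> commutes with its powers.

  The substance is that a vanishing iterate forces the previous one to be a multiple of \<open>C ^ n\<close>.
  Put \<open>v k = C ^ k e\<^sub>0\<close> for integers \<open>k\<close>. The shape of \<open>C\<close> makes the vectors
  \<open>v 0, v 1, v (-1), v 2, v (-2), \<dots>\<close> triangular with respect to the standard basis, with nonzero
  leading entries, so they form a basis of the finitely supported vectors in which \<open>C\<close> is the shift
  \<open>v k \<mapsto> v (k + 1)\<close>; this is the model of \<open>C\<close> as multiplication by \<open>z\<close> on Laurent polynomials.

  Let \<open>g d k\<close> be the coefficient of \<open>\<Omega> (v k)\<close> at \<open>v (k + d)\<close>. In this basis a commutator with \<open>C\<close>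
  is, up to sign and a shift, a difference in \<open>k\<close>, so the hypothesis says that the difference of
  order \<open>n + 1\<close> of each \<open>g d\<close> vanishes. A tridiagonal \<open>\<Omega>\<close> raises the index of the last nonzero
  entry by at most one. For \<open>k \<ge> 1\<close> this excludes \<open>d > 0\<close>, because \<open>v (-k)\<close> directly follows
  \<open>v k\<close> in the ordering; for \<open>k \<le> 0\<close> it excludes \<open>d < 0\<close>, because \<open>v (1 - k)\<close> directly follows
  \<open>v k\<close>. So \<open>g d\<close> vanishes on a half line whenever \<open>d \<noteq> 0\<close>, and then everywhere
  (\<open>iterated_difference_vanishes\<close>). Only \<open>d = 0\<close> is left: the \<open>n\<close>-th iterate maps \<open>v k\<close> to
  \<open>a k \<cdot> v (k + n)\<close>, and \<open>a\<close> does not depend on \<open>k\<close> because its difference vanishes. Hence the iterate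
  agrees with \<open>a C ^ n\<close> on a basis (\<open>ad_pow_eq_scaled_pow\<close>).
\<close>

section \<open>Row-finite matrices as linear operators\<close>

text \<open>All matrices in play are banded, but the algebra rests on rows only: row-finiteness makes
  matrices act on arbitrary sequences, is stable under products, and makes products associative.\<close>

definition row_finite :: "infmat \<Rightarrow> bool" where
  "row_finite A \<longleftrightarrow> (\<forall>i. finite {j. A i j \<noteq> 0})"

definition mvec :: "infmat \<Rightarrow> (nat \<Rightarrow> complex) \<Rightarrow> nat \<Rightarrow> complex" where
  "mvec A x = (\<lambda>i. \<Sum>k. A i k * x k)"

definition unit_vec :: "nat \<Rightarrow> nat \<Rightarrow> complex" where
  "unit_vec j = (\<lambda>i. if i = j then 1 else 0)"

lemma mmult_eq_mvec: "(A \<odot> B) i j = mvec A (\<lambda>k. B k j) i"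
  by (simp add: mmult_def mvec_def)

text \<open>The form with a free finite index set covers vectors of finite support as well as row-finite
  matrices.\<close>
lemma mvec_eq_sum:
  assumes "finite K" "\<And>k. k \<notin> K \<Longrightarrow> A i k * x k = 0"
  shows "mvec A x i = (\<Sum>k\<in>K. A i k * x k)"
  unfolding mvec_def using assms by (intro suminf_finite) auto

lemma mvec_row_finite:
  assumes "row_finite A"
  shows "mvec A x i = (\<Sum>k | A i k \<noteq> 0. A i k * x k)"
  using assms by (intro mvec_eq_sum) (auto simp: row_finite_def)

lemma mvec_unit_vec: "mvec A (unit_vec j) i = A i j"
  by (subst mvec_eq_sum[where K = "{j}"]) (auto simp: unit_vec_def)

lemma row_finite_mult:
  assumes "row_finite A" "row_finite B"
  shows "row_finite (A \<odot> B)"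
  unfolding row_finite_def
proof
  fix i
  have "{j. (A \<odot> B) i j \<noteq> 0} \<subseteq> (\<Union>k\<in>{k. A i k \<noteq> 0}. {j. B k j \<noteq> 0})"
  proof
    fix j assume "j \<in> {j. (A \<odot> B) i j \<noteq> 0}"
    hence "(\<Sum>k | A i k \<noteq> 0. A i k * B k j) \<noteq> 0"
      by (simp add: mmult_eq_mvec mvec_row_finite[OF assms(1)])
    then obtain k where "A i k \<noteq> 0" "A i k * B k j \<noteq> 0"
      by (metis (mono_tags, lifting) mem_Collect_eq sum.neutral)
    thus "j \<in> (\<Union>k\<in>{k. A i k \<noteq> 0}. {j. B k j \<noteq> 0})" by auto
  qed
  moreover have "finite (\<Union>k\<in>{k. A i k \<noteq> 0}. {j. B k j \<noteq> 0})"
    using assms by (auto simp: row_finite_def)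
  ultimately show "finite {j. (A \<odot> B) i j \<noteq> 0}" by (rule finite_subset)
qed

lemma row_finite_minus:
  assumes "row_finite A" "row_finite B"
  shows "row_finite (mminus A B)"
  unfolding row_finite_def
proof
  fix i
  have "{j. mminus A B i j \<noteq> 0} \<subseteq> {j. A i j \<noteq> 0} \<union> {j. B i j \<noteq> 0}"
    by (auto simp: mminus_def)
  thus "finite {j. mminus A B i j \<noteq> 0}"
    by (rule finite_subset) (use assms in \<open>simp add: row_finite_def\<close>)
qed

lemma row_finite_one: "row_finite mone"
  by (simp add: row_finite_def mone_def)

lemma row_finite_pow: "row_finite A \<Longrightarrow> row_finite (mpow A n)"
  by (induction n) (auto intro: row_finite_one row_finite_mult)

lemma row_finite_scale: "row_finite A \<Longrightarrow> row_finite (mscale a A)"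
  unfolding row_finite_def mscale_def by (auto elim: finite_subset[rotated])

lemma row_finite_ad: "row_finite A \<Longrightarrow> row_finite X \<Longrightarrow> row_finite (ad A X)"
  by (simp add: ad_def row_finite_minus row_finite_mult)

lemma row_finite_ad_pow: "row_finite A \<Longrightarrow> row_finite X \<Longrightarrow> row_finite ((ad A ^^ n) X)"
  by (induction n) (auto intro: row_finite_ad)

lemma row_finite_bounded:
  assumes "\<And>i j. f i < j \<Longrightarrow> A i j = 0"
  shows "row_finite A"
  unfolding row_finite_def
proof
  fix i
  have "{j. A i j \<noteq> 0} \<subseteq> {..f i}" using assms not_less by blast
  thus "finite {j. A i j \<noteq> 0}" using finite_subset by blast
qed

lemma mvec_mult:
  assumes "row_finite A" "row_finite B"
  shows "mvec (A \<odot> B) x = mvec A (mvec B x)"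
proof
  fix i
  define K where "K = {k. A i k \<noteq> 0}"
  define J where "J = (\<Union>k\<in>K. {j. B k j \<noteq> 0})"
  have fin: "finite K" "finite J" using assms by (auto simp: row_finite_def K_def J_def)
  have AB: "(A \<odot> B) i j = (\<Sum>k\<in>K. A i k * B k j)" for j
    unfolding mmult_eq_mvec K_def by (rule mvec_row_finite) fact
  have "mvec (A \<odot> B) x i = (\<Sum>j\<in>J. (\<Sum>k\<in>K. A i k * B k j) * x j)"
    unfolding AB[symmetric] using fin
    by (intro mvec_eq_sum) (auto simp: AB J_def intro!: sum.neutral)
  also have "\<dots> = (\<Sum>k\<in>K. A i k * (\<Sum>j\<in>J. B k j * x j))"
    by (simp add: sum_distrib_left sum_distrib_right mult.assoc) (rule sum.swap)
  also have "\<dots> = (\<Sum>k\<in>K. A i k * mvec B x k)"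
    using fin by (intro sum.cong refl arg_cong2[where f = "(*)"] mvec_eq_sum[symmetric])
      (auto simp: J_def)
  also have "\<dots> = mvec A (mvec B x) i"
    unfolding K_def by (rule mvec_row_finite[symmetric]) fact
  finally show "mvec (A \<odot> B) x i = mvec A (mvec B x) i" .
qed

lemma mmult_assoc:
  assumes "row_finite A" "row_finite B"
  shows "A \<odot> B \<odot> D = A \<odot> (B \<odot> D)"
  by (intro ext) (simp add: mmult_eq_mvec mvec_mult[OF assms])

lemma mvec_one: "mvec mone x = x"
  by (rule ext, subst mvec_eq_sum[where K = "{_}"]) (auto simp: mone_def)

lemma mmult_one_left: "mone \<odot> A = A"
  by (intro ext) (simp add: mmult_eq_mvec mvec_one)

lemma mmult_one_right: "A \<odot> mone = A"
proof (intro ext)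
  fix i j
  have "(A \<odot> mone) i j = mvec A (unit_vec j) i"
    by (simp add: mmult_eq_mvec mone_def unit_vec_def)
  thus "(A \<odot> mone) i j = A i j" by (simp add: mvec_unit_vec)
qed

lemma mvec_scale:
  assumes "row_finite A"
  shows "mvec (mscale a A) x i = a * mvec A x i"
proof -
  have "mvec (mscale a A) x i = (\<Sum>k | A i k \<noteq> 0. mscale a A i k * x k)"
    using assms by (intro mvec_eq_sum) (auto simp: row_finite_def mscale_def)
  thus ?thesis by (simp add: mscale_def mvec_row_finite[OF assms] sum_distrib_left mult.assoc)
qed

lemma mvec_minus:
  assumes "row_finite A" "row_finite B"
  shows "mvec (mminus A B) x = mvec A x - mvec B x"
proof
  fix i
  let ?K = "{k. A i k \<noteq> 0} \<union> {k. B i k \<noteq> 0}"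
  have K: "finite ?K" using assms by (simp add: row_finite_def)
  have "mvec D x i = (\<Sum>k\<in>?K. D i k * x k)" if "D \<in> {A, B, mminus A B}" for D
    using that K by (intro mvec_eq_sum) (auto simp: mminus_def)
  thus "mvec (mminus A B) x i = (mvec A x - mvec B x) i"
    by (simp add: mminus_def left_diff_distrib sum_subtractf)
qed

lemma mmult_scale_left: "row_finite A \<Longrightarrow> mscale a A \<odot> B = mscale a (A \<odot> B)"
  by (intro ext) (simp add: mmult_eq_mvec mvec_scale, simp add: mscale_def mmult_eq_mvec)

lemma mmult_scale_right: "row_finite A \<Longrightarrow> A \<odot> mscale a B = mscale a (A \<odot> B)"
  by (intro ext)
    (simp add: mmult_eq_mvec mscale_def mvec_row_finite sum_distrib_left mult.left_commute)

lemma mpow_add: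
  assumes "row_finite A"
  shows "mpow A (m + n) = mpow A m \<odot> mpow A n"
  by (induction m) (simp_all add: mmult_one_left mmult_assoc assms row_finite_pow)

lemma mpow_Suc_right: "row_finite A \<Longrightarrow> mpow A (Suc n) = mpow A n \<odot> A"
  using mpow_add[of A n 1] by (simp add: mmult_one_right)

lemma mpow_inverse:
  assumes "row_finite A" "row_finite B" "A \<odot> B = mone"
  shows "mpow A n \<odot> mpow B n = mone"
proof (induction n)
  case (Suc n)
  have "mpow A (Suc n) \<odot> mpow B (Suc n) = mpow A n \<odot> (A \<odot> B \<odot> mpow B n)"
    unfolding mpow_Suc_right[OF assms(1)]
    by (simp add: mmult_assoc row_finite_pow assms(1,2))
  thus ?case by (simp add: assms(3) mmult_one_left Suc)
qed (simp add: mmult_one_left)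

text \<open>Two-sided cancellation, in the generality that serves both parities of the normalized
  iterate.\<close>
lemma two_sided_quotient_scalar_iff:
  assumes rf: "row_finite U" "row_finite V" "row_finite U'" "row_finite V'" "row_finite Y"
    and inv: "U \<odot> V = mone" "V \<odot> U = mone" "U' \<odot> V' = mone" "V' \<odot> U' = mone"
  shows "V \<odot> Y \<odot> V' = mscale a mone \<longleftrightarrow> Y = mscale a (U \<odot> U')"
proof
  assume eq: "V \<odot> Y \<odot> V' = mscale a mone"
  have "Y = (U \<odot> V) \<odot> Y \<odot> (V' \<odot> U')"
    by (simp add: inv mmult_one_left mmult_one_right)
  also have "\<dots> = U \<odot> (V \<odot> Y \<odot> V') \<odot> U'"
    by (simp add: mmult_assoc row_finite_mult rf)
  also have "\<dots> = mscale a (U \<odot> U')"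
    by (simp add: eq mmult_scale_left mmult_scale_right rf mmult_one_right)
  finally show "Y = mscale a (U \<odot> U')" .
next
  assume "Y = mscale a (U \<odot> U')"
  hence "V \<odot> Y \<odot> V' = mscale a (V \<odot> U \<odot> (U' \<odot> V'))"
    by (simp add: mmult_scale_left mmult_scale_right mmult_assoc row_finite_mult rf)
  thus "V \<odot> Y \<odot> V' = mscale a mone" by (simp add: inv mmult_one_left)
qed

section \<open>Unitarity of the CMV matrix\<close>

lemma Theta_unitary:
  assumes "cmod (\<alpha> n) < 1" "r < 2" "s < 2"
  shows "Theta \<alpha> n r 0 * cnj (Theta \<alpha> n s 0) + Theta \<alpha> n r 1 * cnj (Theta \<alpha> n s 1)
           = (if r = s then 1 else 0)"
proof -
  have "(cmod (\<alpha> n))\<^sup>2 \<le> 1" using assms(1) by (simp add: power_le_one)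
  hence "rho \<alpha> n * rho \<alpha> n = 1 - (cmod (\<alpha> n))\<^sup>2" by (simp add: rho_def)
  hence "complex_of_real (rho \<alpha> n) * complex_of_real (rho \<alpha> n) = 1 - \<alpha> n * cnj (\<alpha> n)"
    by (metis complex_norm_square of_real_1 of_real_diff of_real_mult of_real_power)
  moreover have "r = 0 \<or> r = 1" "s = 0 \<or> s = 1" using assms by auto
  ultimately show ?thesis by (auto simp: Theta_def mult.commute)
qed

lemma Theta_sym: "Theta \<alpha> n r s = Theta \<alpha> n s r"
  by (auto simp: Theta_def)

lemma cmv_L_sym: "cmv_L \<alpha> i j = cmv_L \<alpha> j i"
  by (simp add: cmv_L_def Theta_sym)

text \<open>Deleting the first row and column of \<open>M\<close> leaves the matrix \<open>L\<close> of the shifted coefficients.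
  Facts about \<open>M\<close> are thereby reduced to facts about \<open>L\<close>.\<close>
lemma cmv_M_Suc: "cmv_M \<alpha> (Suc i) (Suc j) = cmv_L (\<lambda>n. \<alpha> (Suc n)) i j"
  by (simp add: cmv_M_def cmv_L_def Theta_def rho_def)

lemma cmv_M_0: "cmv_M \<alpha> 0 j = (if j = 0 then 1 else 0)" "cmv_M \<alpha> i 0 = (if i = 0 then 1 else 0)"
  by (auto simp: cmv_M_def)

lemma cmv_M_sym: "cmv_M \<alpha> i j = cmv_M \<alpha> j i"
  by (cases i; cases j) (simp_all add: cmv_M_0 cmv_M_Suc cmv_L_sym)

lemma mvec_cmv_L:
  "mvec (cmv_L \<alpha>) x i =
     cmv_L \<alpha> i (2 * (i div 2)) * x (2 * (i div 2)) +
     cmv_L \<alpha> i (Suc (2 * (i div 2))) * x (Suc (2 * (i div 2)))"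
proof -
  have "mvec (cmv_L \<alpha>) x i = (\<Sum>k\<in>{2 * (i div 2), Suc (2 * (i div 2))}. cmv_L \<alpha> i k * x k)"
    proof (intro mvec_eq_sum)
    fix k assume "k \<notin> {2 * (i div 2), Suc (2 * (i div 2))}"
    hence "i div 2 \<noteq> k div 2" by auto
    thus "cmv_L \<alpha> i k * x k = 0" by (simp add: cmv_L_def)
  qed simp
  thus ?thesis by simp
qed

lemma cmv_L_unitary:
  assumes "verblunsky \<alpha>"
  shows "cmv_L \<alpha> \<odot> adjoint_mat (cmv_L \<alpha>) = mone"
proof (intro ext)
  fix i j :: nat
  define q where "q = i div 2"
  have "(cmv_L \<alpha> \<odot> adjoint_mat (cmv_L \<alpha>)) i j =
      cmv_L \<alpha> i (2 * q) * cnj (cmv_L \<alpha> j (2 * q)) +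
      cmv_L \<alpha> i (Suc (2 * q)) * cnj (cmv_L \<alpha> j (Suc (2 * q)))"
    by (simp add: mmult_eq_mvec mvec_cmv_L adjoint_mat_def q_def)
  also have "\<dots> = mone i j"
  proof (cases "j div 2 = q")
    case True
    have eq: "i = j \<longleftrightarrow> i mod 2 = j mod 2" using True unfolding q_def by (metis div_mult_mod_eq)
    have "cmod (\<alpha> (2 * q)) < 1" using assms by (simp add: verblunsky_def)
    moreover have "i mod 2 < 2" "j mod 2 < 2" by simp_all
    ultimately have *: "Theta \<alpha> (2 * q) (i mod 2) 0 * cnj (Theta \<alpha> (2 * q) (j mod 2) 0) +
        Theta \<alpha> (2 * q) (i mod 2) 1 * cnj (Theta \<alpha> (2 * q) (j mod 2) 1) = mone i j"
      unfolding mone_def eq by (rule Theta_unitary)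
    have L: "cmv_L \<alpha> l (2 * q) = Theta \<alpha> (2 * q) (l mod 2) 0"
      "cmv_L \<alpha> l (Suc (2 * q)) = Theta \<alpha> (2 * q) (l mod 2) 1" if "l div 2 = q" for l
      using that by (simp_all add: cmv_L_def)
    show ?thesis unfolding L[OF True] L[OF q_def[symmetric]] by (rule *)
  next
    case False
    hence "cmv_L \<alpha> j (2 * q) = 0" "cmv_L \<alpha> j (Suc (2 * q)) = 0" "i \<noteq> j"
      by (auto simp: cmv_L_def q_def)
    thus ?thesis by (simp add: mone_def)
  qed
  finally show "(cmv_L \<alpha> \<odot> adjoint_mat (cmv_L \<alpha>)) i j = mone i j" .
qed


lemma cmv_L_eq_0: "i div 2 \<noteq> j div 2 \<Longrightarrow> cmv_L \<alpha> i j = 0"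
  by (simp add: cmv_L_def)

lemma cmv_M_eq_0: "Suc i div 2 \<noteq> Suc j div 2 \<Longrightarrow> cmv_M \<alpha> i j = 0"
  by (cases i; cases j) (auto simp: cmv_M_0 cmv_M_Suc intro: cmv_L_eq_0)

lemma mvec_cmv_M:
  "mvec (cmv_M \<alpha>) x 0 = x 0"
  "mvec (cmv_M \<alpha>) x (Suc i) = mvec (cmv_L (\<lambda>n. \<alpha> (Suc n))) (\<lambda>k. x (Suc k)) i"
proof -
  show "mvec (cmv_M \<alpha>) x 0 = x 0"
    by (subst mvec_eq_sum[where K = "{0}"]) (auto simp: cmv_M_0)
  define q where "q = i div 2"
  have "mvec (cmv_M \<alpha>) x (Suc i) =
      (\<Sum>k\<in>{Suc (2 * q), Suc (Suc (2 * q))}. cmv_M \<alpha> (Suc i) k * x k)"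
  proof (intro mvec_eq_sum)
    fix k assume "k \<notin> {Suc (2 * q), Suc (Suc (2 * q))}"
    hence "Suc (Suc i) div 2 \<noteq> Suc k div 2" unfolding q_def by auto
    thus "cmv_M \<alpha> (Suc i) k * x k = 0" by (simp add: cmv_M_eq_0)
  qed simp
  thus "mvec (cmv_M \<alpha>) x (Suc i) = mvec (cmv_L (\<lambda>n. \<alpha> (Suc n))) (\<lambda>k. x (Suc k)) i"
    by (simp add: cmv_M_Suc mvec_cmv_L q_def)
qed

lemma cmv_M_unitary:
  assumes "verblunsky \<alpha>"
  shows "cmv_M \<alpha> \<odot> adjoint_mat (cmv_M \<alpha>) = mone"
proof (intro ext)
  fix i j :: nat
  let ?\<beta> = "\<lambda>n. \<alpha> (Suc n)"
  have \<beta>: "verblunsky ?\<beta>" using assms by (simp add: verblunsky_def)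
  show "(cmv_M \<alpha> \<odot> adjoint_mat (cmv_M \<alpha>)) i j = mone i j"
  proof (cases i)
    case 0
    thus ?thesis by (simp add: mmult_eq_mvec mvec_cmv_M adjoint_mat_def cmv_M_0 mone_def)
  next
    case (Suc i')
    show ?thesis
    proof (cases j)
      case 0
      thus ?thesis using Suc
        by (simp add: mmult_eq_mvec mvec_cmv_M mvec_cmv_L adjoint_mat_def cmv_M_0 mone_def)
    next
      case (Suc j')
      have "(cmv_M \<alpha> \<odot> adjoint_mat (cmv_M \<alpha>)) i j = (cmv_L ?\<beta> \<odot> adjoint_mat (cmv_L ?\<beta>)) i' j'"
        by (simp add: \<open>i = Suc i'\<close> Suc mmult_eq_mvec mvec_cmv_M adjoint_mat_def cmv_M_Suc)
      also have "\<dots> = mone i j" by (simp add: cmv_L_unitary[OF \<beta>] mone_def Suc \<open>i = Suc i'\<close>)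
      finally show ?thesis .
    qed
  qed
qed

lemma adjoint_adjoint: "adjoint_mat (adjoint_mat A) = A"
  by (simp add: adjoint_mat_def)

lemma adjoint_mult:
  assumes "row_finite A"
  shows "adjoint_mat (A \<odot> B) = adjoint_mat B \<odot> adjoint_mat A"
proof (intro ext)
  fix i j
  have "(adjoint_mat B \<odot> adjoint_mat A) i j =
      (\<Sum>k | A j k \<noteq> 0. adjoint_mat B i k * adjoint_mat A k j)"
    unfolding mmult_eq_mvec using assms
    by (intro mvec_eq_sum) (auto simp: row_finite_def adjoint_mat_def)
  thus "adjoint_mat (A \<odot> B) i j = (adjoint_mat B \<odot> adjoint_mat A) i j"
    by (simp add: adjoint_mat_def mmult_eq_mvec mvec_row_finite[OF assms] mult.commute)
qed

text \<open>Taking adjoints amounts to conjugating the coefficients, so that each unitarity relation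
  yields the one with the factors exchanged.\<close>
lemma adjoint_cmv_L: "adjoint_mat (cmv_L \<alpha>) = cmv_L (\<lambda>n. cnj (\<alpha> n))"
  by (intro ext) (auto simp: adjoint_mat_def cmv_L_def Theta_def rho_def)

lemma adjoint_cmv_M: "adjoint_mat (cmv_M \<alpha>) = cmv_M (\<lambda>n. cnj (\<alpha> n))"
  by (intro ext) (auto simp: adjoint_mat_def cmv_M_def Theta_def rho_def)

lemma verblunsky_cnj: "verblunsky \<alpha> \<Longrightarrow> verblunsky (\<lambda>n. cnj (\<alpha> n))"
  by (simp add: verblunsky_def)

lemma cmv_L_unitary':
  assumes "verblunsky \<alpha>"
  shows "adjoint_mat (cmv_L \<alpha>) \<odot> cmv_L \<alpha> = mone"
  using cmv_L_unitary[OF verblunsky_cnj[OF assms]]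
  unfolding adjoint_cmv_L[symmetric] adjoint_adjoint .

lemma cmv_M_unitary':
  assumes "verblunsky \<alpha>"
  shows "adjoint_mat (cmv_M \<alpha>) \<odot> cmv_M \<alpha> = mone"
  using cmv_M_unitary[OF verblunsky_cnj[OF assms]]
  unfolding adjoint_cmv_M[symmetric] adjoint_adjoint .

lemma row_finite_cmv_L: "row_finite (cmv_L \<alpha>)"
  by (rule row_finite_bounded[where f = Suc]) (rule cmv_L_eq_0, linarith)

lemma row_finite_cmv_M: "row_finite (cmv_M \<alpha>)"
  by (rule row_finite_bounded[where f = Suc]) (rule cmv_M_eq_0, linarith)

lemma row_finite_CMV: "row_finite (CMV \<alpha>)"
  unfolding CMV_def by (intro row_finite_mult row_finite_cmv_L row_finite_cmv_M)

lemma adjoint_CMV: "adjoint_mat (CMV \<alpha>) = adjoint_mat (cmv_M \<alpha>) \<odot> adjoint_mat (cmv_L \<alpha>)"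
  unfolding CMV_def by (rule adjoint_mult) (rule row_finite_cmv_L)

lemma row_finite_adjoint_cmv_L: "row_finite (adjoint_mat (cmv_L \<alpha>))"
  by (simp add: adjoint_cmv_L row_finite_cmv_L)

lemma row_finite_adjoint_cmv_M: "row_finite (adjoint_mat (cmv_M \<alpha>))"
  by (simp add: adjoint_cmv_M row_finite_cmv_M)

lemma row_finite_adjoint_CMV: "row_finite (adjoint_mat (CMV \<alpha>))"
  unfolding adjoint_CMV
  by (intro row_finite_mult row_finite_adjoint_cmv_L row_finite_adjoint_cmv_M)

lemma mmult_inverse_prod:
  assumes rf: "row_finite A" "row_finite B" "row_finite B'" "row_finite A'"
    and inv: "A \<odot> A' = mone" "B \<odot> B' = mone"
  shows "A \<odot> B \<odot> (B' \<odot> A') = mone"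
proof -
  have "A \<odot> B \<odot> (B' \<odot> A') = A \<odot> (B \<odot> B' \<odot> A')"
    by (simp add: mmult_assoc row_finite_mult rf)
  thus ?thesis by (simp add: inv mmult_one_left)
qed

lemma CMV_unitary:
  assumes "verblunsky \<alpha>"
  shows "CMV \<alpha> \<odot> adjoint_mat (CMV \<alpha>) = mone" "adjoint_mat (CMV \<alpha>) \<odot> CMV \<alpha> = mone"
  unfolding adjoint_CMV unfolding CMV_def
  by (intro mmult_inverse_prod row_finite_cmv_L row_finite_cmv_M row_finite_adjoint_cmv_L
      row_finite_adjoint_cmv_M cmv_L_unitary cmv_M_unitary cmv_L_unitary' cmv_M_unitary' assms)+

section \<open>Shape of the CMV matrix\<close>

lemma CMV_entry:
  "CMV \<alpha> i j = cmv_L \<alpha> i (2 * (i div 2)) * cmv_M \<alpha> (2 * (i div 2)) j +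
     cmv_L \<alpha> i (Suc (2 * (i div 2))) * cmv_M \<alpha> (Suc (2 * (i div 2))) j"
  by (simp add: CMV_def mmult_eq_mvec mvec_cmv_L)

text \<open>The staircase shape of the five-diagonal matrix: the vanishing below the diagonal controls
  how far \<open>C\<close> pushes the end of a finite vector, the vanishing above it does so for the adjoint.\<close>
lemma CMV_eq_0_lower:
  assumes "j \<le> 2 * k" "2 * k + 1 < i"
  shows "CMV \<alpha> i j = 0"
proof -
  have "k < i div 2" "Suc j div 2 \<le> k" using assms by linarith+
  moreover have "Suc (2 * q) div 2 = q" "Suc (Suc (2 * q)) div 2 = Suc q" for q :: nat by simp_all
  ultimately have "Suc (2 * (i div 2)) div 2 \<noteq> Suc j div 2"
    "Suc (Suc (2 * (i div 2))) div 2 \<noteq> Suc j div 2"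
    by linarith+
  thus ?thesis unfolding CMV_entry by (simp only: cmv_M_eq_0 mult_zero_right add_0_right not_False_eq_True)
qed

lemma CMV_eq_0_upper:
  assumes "i \<le> 2 * k + 1" "2 * k + 2 < j"
  shows "CMV \<alpha> i j = 0"
proof -
  have "i div 2 \<le> k" "k + 1 < Suc j div 2" using assms by linarith+
  moreover have "Suc (2 * q) div 2 = q" "Suc (Suc (2 * q)) div 2 = Suc q" for q :: nat by simp_all
  ultimately have "Suc (2 * (i div 2)) div 2 \<noteq> Suc j div 2"
    "Suc (Suc (2 * (i div 2))) div 2 \<noteq> Suc j div 2"
    by linarith+
  thus ?thesis unfolding CMV_entry by (simp only: cmv_M_eq_0 mult_zero_right add_0_right not_False_eq_True)
qed

lemma rho_nonzero:
  assumes "verblunsky \<alpha>"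
  shows "rho \<alpha> n \<noteq> 0"
proof -
  have "(cmod (\<alpha> n))\<^sup>2 < 1" using assms by (simp add: verblunsky_def abs_square_less_1)
  thus ?thesis by (simp add: rho_def)
qed

text \<open>The entries at the outer corners of the staircase are products of two \<open>\<rho>\<close>'s, or a single
  one in the first column. They are what keeps the leading entries of the vectors \<open>C ^ k e\<^sub>0\<close>
  from vanishing.\<close>
lemma CMV_corner:
  assumes "verblunsky \<alpha>"
  shows "CMV \<alpha> 1 0 \<noteq> 0"
    and "CMV \<alpha> (2 * k + 3) (2 * k + 1) \<noteq> 0"
    and "CMV \<alpha> (2 * k) (2 * k + 2) \<noteq> 0"
proof -
  have L: "cmv_L \<alpha> (2 * k) (Suc (2 * k)) \<noteq> 0" if "verblunsky \<alpha>" for \<alpha> k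
    using rho_nonzero[OF that] by (simp add: cmv_L_def Theta_def)
  have M: "cmv_M \<alpha> (Suc (2 * k)) (Suc (Suc (2 * k))) \<noteq> 0" for k
    unfolding cmv_M_Suc using assms by (intro L) (simp add: verblunsky_def)
  have z: "cmv_M \<alpha> (Suc (Suc (Suc (2 * k)))) (Suc (2 * k)) = 0"
    "cmv_M \<alpha> (2 * k) (Suc (Suc (2 * k))) = 0" for k
    by (rule cmv_M_eq_0, simp)+
  show "CMV \<alpha> 1 0 \<noteq> 0"
    using L[OF assms, of 0] by (simp add: CMV_entry cmv_M_0 cmv_L_sym)
  have d: "Suc (Suc (Suc (2 * k))) div 2 = Suc k" by simp
  have "cmv_L \<alpha> (Suc (Suc (Suc (2 * k)))) (2 * Suc k) \<noteq> 0"
    using L[OF assms, of "Suc k"] by (subst cmv_L_sym) simp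
  moreover have "cmv_M \<alpha> (2 * Suc k) (Suc (2 * k)) \<noteq> 0"
    using M[of k] by (subst cmv_M_sym) simp
  ultimately have "CMV \<alpha> (Suc (Suc (Suc (2 * k)))) (Suc (2 * k)) \<noteq> 0"
    unfolding CMV_entry d using z(1)[of k] by simp
  thus "CMV \<alpha> (2 * k + 3) (2 * k + 1) \<noteq> 0" by (simp add: numeral_3_eq_3)
  have "CMV \<alpha> (2 * k) (Suc (Suc (2 * k))) \<noteq> 0"
    unfolding CMV_entry using L[OF assms, of k] M[of k] by (simp add: z)
  thus "CMV \<alpha> (2 * k) (2 * k + 2) \<noteq> 0" by simp
qed

section \<open>Iterated differences on the integers\<close>

text \<open>If \<^term>\<open>h (Suc j)\<close> vanishes everywhere, then \<^term>\<open>h j\<close> is constant. Differencing preserves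
  vanishing near one end of the integers, so that constant can be read off there and is zero. This
  descends from \<^term>\<open>h N\<close> to \<^term>\<open>h 0\<close>.\<close>
lemma iterated_difference_vanishes:
  fixes h :: "nat \<Rightarrow> int \<Rightarrow> 'a :: ab_group_add"
  assumes diff: "\<And>j k. h (Suc j) k = h j k - h j (k + 1)"
    and final: "\<And>k. h N k = 0"
    and half: "(\<forall>k\<ge>k0. h 0 k = 0) \<or> (\<forall>k\<le>k0. h 0 k = 0)"
  shows "j \<le> N \<Longrightarrow> h j k = 0"
proof (induction arbitrary: k rule: inc_induct)
  case base
  show ?case by (rule final)
next
  case (step j)
  have const: "h j (l + 1) = h j l" for l using diff[of j l] step.IH[of l] by simp
  have "h j l = h j 0" for l
  proof (induction l rule: int_induct[where k = 0])
    case (step2 i)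
    thus ?case using const[of "i - 1"] by simp
  qed (simp_all add: const)
  moreover have "(\<forall>l\<ge>k0. h i l = 0) \<or> (\<forall>l\<le>k0 - int i. h i l = 0)" for i
  proof (induction i)
    case (Suc i)
    thus ?case by (auto simp: diff)
  qed (use half in simp)
  hence "\<exists>l. h j l = 0" by blast
  ultimately show ?case by metis
qed

section \<open>Bases on which a matrix acts as the shift\<close>

definition has_top :: "(nat \<Rightarrow> complex) \<Rightarrow> nat \<Rightarrow> bool" where
  "has_top x n \<longleftrightarrow> x n \<noteq> 0 \<and> (\<forall>i>n. x i = 0)"

text \<open>At a corner of a staircase-shaped matrix no cancellation can occur: row \<open>n\<close> meets only the last
  entry of \<open>x\<close>, and the rows below it meet none.\<close>
lemma has_top_mvec:
  assumes "has_top x m" "A n m \<noteq> 0"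
    and "\<And>j. j < m \<Longrightarrow> A n j = 0"
    and "\<And>i j. j \<le> m \<Longrightarrow> n < i \<Longrightarrow> A i j = 0"
  shows "has_top (mvec A x) n"
  unfolding has_top_def
proof (intro conjI allI impI)
  have "mvec A x n = (\<Sum>k\<in>{m}. A n k * x k)"
    using assms(1,3) by (intro mvec_eq_sum) (auto simp: has_top_def neq_iff)
  thus "mvec A x n \<noteq> 0" using assms(1,2) by (simp add: has_top_def)
next
  fix i assume "n < i"
  have "A i k * x k = 0" for k
    using assms(1,4) \<open>n < i\<close> by (cases "k \<le> m") (auto simp: has_top_def)
  thus "mvec A x i = 0" by (subst mvec_eq_sum[where K = "{}"]) auto
qed

lemma has_top_unique: "has_top x m \<Longrightarrow> has_top x n \<Longrightarrow> m = n"
  unfolding has_top_def by (metis linorder_neqE_nat)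

definition vscale :: "complex \<Rightarrow> (nat \<Rightarrow> complex) \<Rightarrow> nat \<Rightarrow> complex" where
  "vscale a x = (\<lambda>i. a * x i)"

interpretation vec: vector_space vscale
  by unfold_locales (auto simp: vscale_def fun_eq_iff algebra_simps)

lemma mvec_linear:
  assumes "row_finite A"
  shows "Vector_Spaces.linear vscale vscale (mvec A)"
  by unfold_locales
    (auto simp: vscale_def fun_eq_iff mvec_row_finite[OF assms] sum.distrib distrib_left
      sum_distrib_left mult.left_commute)

lemma sum_fun_apply: "(\<Sum>a\<in>T. f a) i = (\<Sum>a\<in>T. f a i)"
  by (induction T rule: infinite_finite_induct) auto

text \<open>The place of \<open>k\<close> in the enumeration \<open>0, 1, -1, 2, -2, \<dots>\<close> of the integers, which is the order in
  which the CMV basis orthonormalizes the Laurent monomials.\<close>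
definition cmv_position :: "int \<Rightarrow> nat" where
  "cmv_position k = (if 1 \<le> k then nat (2 * k - 1) else nat (- (2 * k)))"

lemma cmv_position_inj: "cmv_position k = cmv_position l \<Longrightarrow> k = l"
proof (cases "1 \<le> k"; cases "1 \<le> l")
  assume "cmv_position k = cmv_position l" "1 \<le> k" "\<not> 1 \<le> l"
  hence "2 * k - 1 = - (2 * l)" by (simp add: cmv_position_def)
  thus ?thesis by presburger
next
  assume "cmv_position k = cmv_position l" "\<not> 1 \<le> k" "1 \<le> l"
  hence "- (2 * k) = 2 * l - 1" by (simp add: cmv_position_def)
  thus ?thesis by presburger
qed (auto simp: cmv_position_def)

lemma cmv_position_surj: "\<exists>k. cmv_position k = n"
proof (cases "even n")
  case True
  then obtain m where "n = 2 * m" by blast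
  hence "cmv_position (- int m) = n" by (simp add: cmv_position_def)
  thus ?thesis by blast
next
  case False
  then obtain m where "n = 2 * m + 1" by (elim oddE)
  hence "cmv_position (int m + 1) = n" by (simp add: cmv_position_def)
  thus ?thesis by blast
qed

text \<open>The abstract form of multiplication by \<open>z\<close> on Laurent polynomials: \<open>v k\<close> stands for \<open>z ^ k\<close>,
  expanded in a basis obtained from the monomials by triangular elimination in the above order.\<close>
locale laurent_basis =
  fixes C :: infmat and v :: "int \<Rightarrow> nat \<Rightarrow> complex"
  assumes row_finite_C: "row_finite C"
    and shift: "mvec C (v k) = v (k + 1)"
    and top: "has_top (v k) (cmv_position k)"
begin

lemma inj_v: "inj v"
  by (rule injI) (metis cmv_position_inj has_top_unique top)

text \<open>Triangular elimination: subtracting a multiple of the basis vector with leading index \<open>n\<close>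
  removes the entry \<open>n\<close>.\<close>
lemma supported_in_span:
  assumes "\<And>i. n \<le> i \<Longrightarrow> x i = 0"
  shows "x \<in> vec.span (v ` {k. cmv_position k < n})"
  using assms
proof (induction n arbitrary: x)
  case 0
  hence "x = 0" by (simp add: fun_eq_iff)
  thus ?case by (simp only: vec.span_zero)
next
  case (Suc n)
  obtain k where k: "cmv_position k = n" using cmv_position_surj by blast
  have vk: "v k n \<noteq> 0" "\<And>i. n < i \<Longrightarrow> v k i = 0" using top[of k] k by (auto simp: has_top_def)
  define y where "y = x - vscale (x n / v k n) (v k)"
  have "y i = 0" if "n \<le> i" for i
    using that Suc.prems[of i] vk by (cases "i = n") (auto simp: y_def vscale_def)
  hence "y \<in> vec.span (v ` {k. cmv_position k < n})" by (rule Suc.IH)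
  also have "\<dots> \<subseteq> vec.span (v ` {k. cmv_position k < Suc n})"
    by (intro vec.span_mono image_mono) auto
  finally have "y + vscale (x n / v k n) (v k) \<in> vec.span (v ` {k. cmv_position k < Suc n})"
    using k by (intro vec.span_add[OF _ vec.span_scale[OF vec.span_base]]) auto
  thus ?case by (simp add: y_def)
qed

lemma unit_vec_in_span: "unit_vec j \<in> vec.span (range v)"
proof -
  have "unit_vec j \<in> vec.span (v ` {k. cmv_position k < Suc j})"
    by (rule supported_in_span) (simp add: unit_vec_def)
  also have "\<dots> \<subseteq> vec.span (range v)" by (intro vec.span_mono) auto
  finally show ?thesis .
qed

text \<open>In a linear relation the vector with the largest leading index cannot be cancelled.\<close>
lemma independent_range: "vec.independent (range v)"
proof (unfold vec.independent_explicit_module, intro allI impI, rule ccontr)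
  fix T u w
  assume T: "finite T" "T \<subseteq> range v" and sum0: "(\<Sum>x\<in>T. vscale (u x) x) = 0"
    and w: "w \<in> T" "u w \<noteq> 0"
  define K where "K = {k. v k \<in> T \<and> u (v k) \<noteq> 0}"
  have "K \<subseteq> v -` T" by (auto simp: K_def)
  hence "finite K" using finite_vimageI[OF T(1) inj_v] finite_subset by blast
  moreover have "K \<noteq> {}" using w T(2) by (auto simp: K_def)
  ultimately obtain k where k: "k \<in> K" "\<And>l. l \<in> K \<Longrightarrow> cmv_position l \<le> cmv_position k"
    using Max_in[of "cmv_position ` K"] Max_ge[of "cmv_position ` K"]
    by (metis (no_types, lifting) finite_imageI image_iff image_is_empty)
  let ?N = "cmv_position k"
  have "vscale (u x) x ?N = 0" if x: "x \<in> T - {v k}" for x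
  proof (rule ccontr)
    assume ne: "vscale (u x) x ?N \<noteq> 0"
    obtain l where l: "x = v l" using x T(2) by blast
    hence "l \<in> K" "l \<noteq> k" using ne x by (auto simp: K_def vscale_def)
    hence "cmv_position l < ?N" using k(2) cmv_position_inj[of l k] by fastforce
    thus False using ne top[of l] l by (simp add: has_top_def vscale_def)
  qed
  hence "(\<Sum>x\<in>T. vscale (u x) x) ?N = vscale (u (v k)) (v k) ?N"
    using k(1) T(1) by (simp add: sum_fun_apply K_def sum.remove[of T "v k"])
  hence "u (v k) * v k ?N = 0" using sum0 by (simp add: vscale_def)
  thus False using k(1) top[of k] by (simp add: K_def has_top_def)
qed

definition coord :: "int \<Rightarrow> (nat \<Rightarrow> complex) \<Rightarrow> complex" where
  "coord k x = vec.representation (range v) x (v k)"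

lemma coord_outside:
  assumes "x \<in> vec.span (v ` K)" "k \<notin> K"
  shows "coord k x = 0"
proof -
  have "vec.representation (range v) x = vec.representation (v ` K) x"
    by (rule vec.representation_extend[OF independent_range assms(1)]) auto
  thus ?thesis
    using vec.representation_ne_zero[of "v ` K" x "v k"] assms(2) inj_v
    by (auto simp: coord_def dest: injD)
qed

lemma coord_basis: "coord k (v l) = (if k = l then 1 else 0)"
  by (auto simp: coord_def vec.representation_basis[OF independent_range] inj_eq[OF inj_v])

lemma coord_zero: "coord k 0 = 0"
  unfolding coord_def vec.representation_zero ..

lemma coord_add: "x \<in> vec.span (range v) \<Longrightarrow> y \<in> vec.span (range v) \<Longrightarrow>
    coord k (x + y) = coord k x + coord k y"
  by (simp add: coord_def vec.representation_add[OF independent_range])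

lemma coord_diff: "x \<in> vec.span (range v) \<Longrightarrow> y \<in> vec.span (range v) \<Longrightarrow>
    coord k (x - y) = coord k x - coord k y"
  by (simp add: coord_def vec.representation_diff[OF independent_range])

lemma coord_scale: "x \<in> vec.span (range v) \<Longrightarrow> coord k (vscale a x) = a * coord k x"
  by (simp add: coord_def vec.representation_scale[OF independent_range])

text \<open>Coordinates are additive only on the span, so the invariance of the span has to be carried
  along in the induction.\<close>
lemma span_shift:
  assumes "x \<in> vec.span (range v)"
  shows "mvec C x \<in> vec.span (range v) \<and> coord (k + 1) (mvec C x) = coord k x"
proof -
  interpret C: Vector_Spaces.linear vscale vscale "mvec C" by (rule mvec_linear[OF row_finite_C])
  have "x \<in> vec.span (range v) \<and> mvec C x \<in> vec.span (range v) \<and>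
      coord (k + 1) (mvec C x) = coord k x"
    using assms
  proof (induction rule: vec.span_induct_alt)
    case base
    show ?case unfolding C.zero using vec.span_zero coord_zero by metis
  next
    case (step c x y)
    then obtain l where l: "x = v l" by blast
    have v: "v m \<in> vec.span (range v)" for m by (rule vec.span_base) simp
    have eq: "mvec C (vscale c x + y) = vscale c (v (l + 1)) + mvec C y"
      by (simp only: l C.add C.scale shift)
    show ?case unfolding eq unfolding l using step(2) v
      by (simp only: vec.span_add vec.span_scale coord_add coord_scale coord_basis) simp
  qed
  thus ?thesis by blast
qed

lemma eq_scale_basis:
  assumes "x \<in> vec.span (range v)" "\<And>l. l \<noteq> k \<Longrightarrow> coord l x = 0"
  shows "x = vscale (coord k x) (v k)"
proof -
  have "{b. vec.representation (range v) x b \<noteq> 0} \<subseteq> {v k}"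
  proof
    fix b assume b: "b \<in> {b. vec.representation (range v) x b \<noteq> 0}"
    then obtain l where l: "b = v l" using vec.representation_ne_zero[of "range v" x b] by blast
    with b have "coord l x \<noteq> 0" by (simp add: coord_def)
    hence "l = k" using assms(2) by metis
    thus "b \<in> {v k}" by (simp only: l singletonI)
  qed
  hence "(\<Sum>b | vec.representation (range v) x b \<noteq> 0. vscale (vec.representation (range v) x b) b) =
      (\<Sum>b\<in>{v k}. vscale (vec.representation (range v) x b) b)"
    by (intro sum.mono_neutral_left) auto
  thus ?thesis
    using vec.sum_nonzero_representation_eq[OF independent_range assms(1)] by (simp add: coord_def)
qed

lemma mvec_ad_pow:
  assumes "row_finite X"
  shows "mvec ((ad C ^^ Suc j) X) (v k) =
    mvec C (mvec ((ad C ^^ j) X) (v k)) - mvec ((ad C ^^ j) X) (v (k + 1))"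
proof -
  let ?Y = "(ad C ^^ j) X"
  have Y: "row_finite ?Y" by (intro row_finite_ad_pow row_finite_C assms)
  thus ?thesis
    by (auto simp: ad_def mvec_minus row_finite_mult row_finite_C Y mvec_mult shift)
qed

text \<open>The coefficients \<open>h d j k\<close> of the \<open>j\<close>-th iterate, on the \<open>d\<close>-th diagonal relative to
  \<open>C ^ j\<close>, turn commutators into differences. The condition on \<open>\<Omega>\<close> puts \<open>h d 0\<close> to zero on a half
  line unless \<open>d = 0\<close>.\<close>
lemma ad_pow_eq_scaled_pow:
  assumes \<Omega>: "row_finite \<Omega>" "\<And>i j. Suc j < i \<Longrightarrow> \<Omega> i j = 0"
    and nil: "(ad C ^^ (n + 1)) \<Omega> = mzero"
  shows "\<exists>a. (ad C ^^ n) \<Omega> = mscale a (mpow C n)"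
proof -
  define X where "X j = (ad C ^^ j) \<Omega>" for j
  have X_Suc: "mvec (X (Suc j)) (v k) = mvec C (mvec (X j) (v k)) - mvec (X j) (v (k + 1))" for j k
    unfolding X_def by (rule mvec_ad_pow) (rule \<Omega>(1))
  have rfX: "row_finite (X j)" for j
    unfolding X_def by (intro row_finite_ad_pow row_finite_C \<Omega>(1))
  have \<Omega>_span: "mvec \<Omega> (v k) \<in> vec.span (v ` {l. cmv_position l < cmv_position k + 2})" for k
  proof (rule supported_in_span)
    fix i assume i: "cmv_position k + 2 \<le> i"
    have "\<Omega> i j * v k j = 0" for j
    proof (cases "j \<le> cmv_position k")
      case True
      thus ?thesis using \<Omega>(2) i by simp
    qed (use top[of k] in \<open>simp add: has_top_def\<close>)
    thus "mvec \<Omega> (v k) i = 0" by (subst mvec_eq_sum[where K = "{}"]) auto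
  qed
  have span: "mvec (X j) (v k) \<in> vec.span (range v)" for j k
  proof (induction j arbitrary: k)
    case 0
    have "vec.span (v ` {l. cmv_position l < cmv_position k + 2}) \<subseteq> vec.span (range v)"
      by (intro vec.span_mono) auto
    thus ?case using \<Omega>_span[of k] unfolding X_def by auto
  next
    case (Suc j)
    thus ?case unfolding X_Suc using span_shift by (intro vec.span_diff) auto
  qed
  define h where "h d j k = coord (k + int j + d) (mvec (X j) (v k))" for d j k
  have diff: "h d (Suc j) k = h d j k - h d j (k + 1)" for d j k
  proof -
    have "h d (Suc j) k =
        coord (k + int j + d + 1) (mvec C (mvec (X j) (v k))) -
        coord (k + int j + d + 1) (mvec (X j) (v (k + 1)))"
      using span span_shift
      by (simp add: h_def X_Suc coord_diff algebra_simps)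
    also have "coord (k + int j + d + 1) (mvec C (mvec (X j) (v k))) = h d j k"
      using span_shift[OF span] by (simp add: h_def)
    finally show ?thesis by (simp add: h_def algebra_simps)
  qed
  have hN: "h d (Suc n) k = 0" for d k
  proof -
    have "mvec (X (Suc n)) (v k) = 0"
      using nil by (simp add: X_def mzero_def mvec_def fun_eq_iff)
    thus ?thesis by (simp only: h_def coord_zero)
  qed
  \<comment> \<open>The indices with position below that of \<open>k\<close> plus two are those from \<open>-k\<close> to \<open>k\<close> if \<open>k \<ge> 1\<close>,
    and those from \<open>k\<close> to \<open>1 - k\<close> if \<open>k \<le> 0\<close>.\<close>
  have start: "h d 0 k = 0" if "if 0 < d then 1 \<le> k else k \<le> 0" "d \<noteq> 0" for d k
    unfolding h_def
  proof (rule coord_outside)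
    show "mvec (X 0) (v k) \<in> vec.span (v ` {l. cmv_position l < cmv_position k + 2})"
      using \<Omega>_span[of k] by (simp add: X_def)
    show "k + int 0 + d \<notin> {l. cmv_position l < cmv_position k + 2}"
      using that by (auto simp: cmv_position_def split: if_splits)
  qed
  have off_diagonal: "h d n k = 0" if "d \<noteq> 0" for d k
  proof (rule iterated_difference_vanishes[where h = "h d" and N = "Suc n"])
    show "(\<forall>k\<ge>(if 0 < d then 1 else 0). h d 0 k = 0) \<or>
        (\<forall>k\<le>(if 0 < d then 1 else 0). h d 0 k = 0)"
      using start[of d] that by auto
  qed (rule diff, rule hN, simp)
  define a where "a = h 0 n 0"
  have "h 0 n k = a" for k
  proof (induction k rule: int_induct[where k = 0])
    case (step1 i)
    thus ?case using diff[of 0 n i] hN[of 0 i] by simp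
  next
    case (step2 i)
    thus ?case using diff[of 0 n "i - 1"] hN[of 0 "i - 1"] by simp
  qed (simp add: a_def)
  hence X_v: "mvec (X n) (v k) = vscale a (v (k + int n))" for k
    using eq_scale_basis[OF span, where k = "k + int n" and j1 = n and k1 = k]
      off_diagonal[of "_ - (k + int n)" k] by (simp add: h_def)
  have pow_v: "mvec (mpow C m) (v k) = v (k + int m)" for m k
    by (induction m) (simp_all add: mvec_one mvec_mult row_finite_C row_finite_pow shift add_ac)
  have rfP: "row_finite (mpow C n)" by (intro row_finite_pow row_finite_C)
  have scale: "mvec (mscale a (mpow C n)) x = vscale a (mvec (mpow C n) x)" for x
    by (intro ext) (simp add: vscale_def mvec_scale[OF rfP])
  interpret pair: module_pair vscale vscale by unfold_locales
  have "mvec (X n) x = mvec (mscale a (mpow C n)) x" if "x \<in> vec.span (range v)" for x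
    by (rule pair.module_hom_eq_on_span[OF mvec_linear[OF rfX, unfolded linear_iff_module_hom]
          mvec_linear[OF row_finite_scale[OF rfP], unfolded linear_iff_module_hom] _ that])
      (auto simp: X_v scale pow_v)
  hence "X n i j = mscale a (mpow C n) i j" for i j
    using unit_vec_in_span[of j] by (metis mvec_unit_vec)
  hence "X n = mscale a (mpow C n)" by blast
  thus ?thesis unfolding X_def by blast
qed

end

section \<open>The CMV matrix as a shift\<close>

definition cmv_vec :: "(nat \<Rightarrow> complex) \<Rightarrow> int \<Rightarrow> nat \<Rightarrow> complex" where
  "cmv_vec \<alpha> k = mvec (if 0 \<le> k then mpow (CMV \<alpha>) (nat k)
                      else mpow (adjoint_mat (CMV \<alpha>)) (nat (- k))) (unit_vec 0)"

lemma cmv_vec_0: "cmv_vec \<alpha> 0 = unit_vec 0"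
  by (simp add: cmv_vec_def mvec_one)

lemma cmv_vec_neg: "cmv_vec \<alpha> (- int k) = mvec (mpow (adjoint_mat (CMV \<alpha>)) k) (unit_vec 0)"
  by (cases "k = 0") (simp_all add: cmv_vec_def)

lemma cmv_vec_neg_Suc:
  "cmv_vec \<alpha> (- int (Suc k)) = mvec (adjoint_mat (CMV \<alpha>)) (cmv_vec \<alpha> (- int k))"
  unfolding cmv_vec_neg by (simp add: mvec_mult row_finite_adjoint_CMV row_finite_pow)

lemma cmv_vec_shift:
  assumes "verblunsky \<alpha>"
  shows "mvec (CMV \<alpha>) (cmv_vec \<alpha> k) = cmv_vec \<alpha> (k + 1)"
proof (cases "0 \<le> k")
  case True
  hence "nat (k + 1) = Suc (nat k)" by simp
  thus ?thesis using True by (simp add: cmv_vec_def mvec_mult row_finite_CMV row_finite_pow)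
next
  case False
  then obtain m where m: "k = - int (Suc m)" by (metis negD not_le)
  have "mvec (CMV \<alpha>) (cmv_vec \<alpha> k) = cmv_vec \<alpha> (- int m)"
    unfolding m cmv_vec_neg_Suc
    by (simp add: CMV_unitary[OF assms] mvec_one row_finite_CMV row_finite_adjoint_CMV
        flip: mvec_mult)
  thus ?thesis by (simp add: m)
qed

text \<open>Each application of \<open>C\<close> or of its adjoint moves the last nonzero entry by two, from one corner
  of the staircase to the next; only the first application of \<open>C\<close> moves it by one.\<close>
lemma has_top_cmv_vec_pos:
  assumes "verblunsky \<alpha>"
  shows "has_top (cmv_vec \<alpha> (int k + 1)) (2 * k + 1)"
proof (induction k)
  case 0
  have "has_top (mvec (CMV \<alpha>) (cmv_vec \<alpha> 0)) 1"
  proof (rule has_top_mvec)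
    show "has_top (cmv_vec \<alpha> 0) 0" by (simp add: cmv_vec_0 has_top_def unit_vec_def)
    show "CMV \<alpha> 1 0 \<noteq> 0" by (rule CMV_corner) fact
    show "CMV \<alpha> i j = 0" if "j \<le> 0" "1 < i" for i j
      using that by (intro CMV_eq_0_lower[where k = 0]) auto
  qed simp
  thus ?case by (simp add: cmv_vec_shift[OF assms])
next
  case (Suc k)
  have "has_top (mvec (CMV \<alpha>) (cmv_vec \<alpha> (int k + 1))) (2 * k + 3)"
  proof (rule has_top_mvec[OF Suc.IH])
    show "CMV \<alpha> (2 * k + 3) (2 * k + 1) \<noteq> 0" by (rule CMV_corner) fact
    show "CMV \<alpha> (2 * k + 3) j = 0" if "j < 2 * k + 1" for j
      using that by (intro CMV_eq_0_lower[where k = k]) auto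
    show "CMV \<alpha> i j = 0" if "j \<le> 2 * k + 1" "2 * k + 3 < i" for i j
      using that by (intro CMV_eq_0_lower[where k = "Suc k"]) auto
  qed
  thus ?case by (simp add: cmv_vec_shift[OF assms] numeral_3_eq_3 add_ac)
qed

lemma has_top_cmv_vec_neg:
  assumes "verblunsky \<alpha>"
  shows "has_top (cmv_vec \<alpha> (- int k)) (2 * k)"
proof (induction k)
  case 0
  show ?case by (simp add: cmv_vec_0 has_top_def unit_vec_def)
next
  case (Suc k)
  have "has_top (mvec (adjoint_mat (CMV \<alpha>)) (cmv_vec \<alpha> (- int k))) (2 * k + 2)"
  proof (rule has_top_mvec[OF Suc.IH])
    show "adjoint_mat (CMV \<alpha>) (2 * k + 2) (2 * k) \<noteq> 0"
      using CMV_corner(3)[OF assms] by (simp add: adjoint_mat_def)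
    show "adjoint_mat (CMV \<alpha>) (2 * k + 2) j = 0" if "j < 2 * k" for j
      using that CMV_eq_0_upper[of j "k - 1" "2 * k + 2"] by (simp add: adjoint_mat_def)
    show "adjoint_mat (CMV \<alpha>) i j = 0" if "j \<le> 2 * k" "2 * k + 2 < i" for i j
      using that CMV_eq_0_upper[of j k i] by (simp add: adjoint_mat_def)
  qed
  thus ?case unfolding cmv_vec_neg_Suc by simp
qed

lemma CMV_laurent_basis:
  assumes "verblunsky \<alpha>"
  shows "laurent_basis (CMV \<alpha>) (cmv_vec \<alpha>)"
proof
  show "row_finite (CMV \<alpha>)" by (rule row_finite_CMV)
  show "mvec (CMV \<alpha>) (cmv_vec \<alpha> k) = cmv_vec \<alpha> (k + 1)" for k
    by (rule cmv_vec_shift) fact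
  show "has_top (cmv_vec \<alpha> k) (cmv_position k)" for k
  proof (cases "1 \<le> k")
    case True
    hence "k = int (nat (k - 1)) + 1" "cmv_position k = 2 * nat (k - 1) + 1"
      by (simp_all add: cmv_position_def nat_diff_distrib nat_mult_distrib)
    thus ?thesis using has_top_cmv_vec_pos[OF assms] by metis
  next
    case False
    hence "k = - int (nat (- k))" "cmv_position k = 2 * nat (- k)"
      by (simp_all add: cmv_position_def)
    thus ?thesis using has_top_cmv_vec_neg[OF assms] by metis
  qed
qed

section \<open>Normalized iterates and the three conditions\<close>

text \<open>For \<open>n = 2m\<close> the outer factors invert \<open>C ^ m\<close> on both sides; for \<open>n = 2m + 1\<close> they invert
  \<open>C ^ m L\<close> and \<open>M C ^ m\<close>, whose product is \<open>C ^ (2m + 1)\<close> because \<open>C = L M\<close>.\<close>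
lemma ad_sub_scalar_iff:
  assumes "verblunsky \<alpha>" "row_finite \<Omega>"
  shows "ad_sub n \<alpha> \<Omega> = mscale a mone \<longleftrightarrow> (ad (CMV \<alpha>) ^^ n) \<Omega> = mscale a (mpow (CMV \<alpha>) n)"
proof -
  define C m Y where "C = CMV \<alpha>" and "m = n div 2" and "Y = (ad (CMV \<alpha>) ^^ n) \<Omega>"
  define U P where "U = mpow C m" and "P = mpow (adjoint_mat C) m"
  let ?L = "cmv_L \<alpha>" and ?M = "cmv_M \<alpha>"
  have rf: "row_finite C" "row_finite U" "row_finite P" "row_finite Y"
    unfolding U_def P_def Y_def C_def
    by (intro row_finite_pow row_finite_ad_pow row_finite_CMV row_finite_adjoint_CMV assms)+
  have UP: "U \<odot> P = mone" "P \<odot> U = mone"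
    unfolding U_def P_def C_def
    by (intro mpow_inverse row_finite_CMV row_finite_adjoint_CMV CMV_unitary assms)+
  note rfLM = row_finite_cmv_L row_finite_cmv_M row_finite_adjoint_cmv_L row_finite_adjoint_cmv_M
  show ?thesis
  proof (cases "even n")
    case True
    hence "n = m + m" unfolding m_def by presburger
    hence "mpow C n = U \<odot> U" unfolding U_def by (metis mpow_add rf(1))
    moreover have "ad_sub n \<alpha> \<Omega> = P \<odot> Y \<odot> P"
      using True by (simp add: ad_sub_def Let_def P_def Y_def C_def m_def)
    ultimately show ?thesis
      using two_sided_quotient_scalar_iff[OF rf(2,3,2,3,4) UP UP(1,2)]
      by (simp add: Y_def C_def)
  next
    case False
    hence "n = m + Suc m" unfolding m_def by presburger
    hence "mpow C n = U \<odot> (C \<odot> U)" unfolding U_def by (metis mpow_add mpow.simps(2) rf(1))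
    hence pow: "mpow C n = (U \<odot> ?L) \<odot> (?M \<odot> U)"
      by (simp add: C_def CMV_def mmult_assoc row_finite_mult rf(2) rfLM)
    have "ad_sub n \<alpha> \<Omega> = adjoint_mat ?L \<odot> P \<odot> Y \<odot> P \<odot> adjoint_mat ?M"
      using False by (simp add: ad_sub_def Let_def P_def Y_def C_def m_def)
    hence sub: "ad_sub n \<alpha> \<Omega> = (adjoint_mat ?L \<odot> P) \<odot> Y \<odot> (P \<odot> adjoint_mat ?M)"
      by (simp add: mmult_assoc row_finite_mult rf rfLM)
    have "ad_sub n \<alpha> \<Omega> = mscale a mone \<longleftrightarrow> Y = mscale a (mpow C n)"
      unfolding sub pow
      by (intro two_sided_quotient_scalar_iff mmult_inverse_prod row_finite_mult rf rfLM UP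
          cmv_L_unitary cmv_L_unitary' cmv_M_unitary cmv_M_unitary' assms)
    thus ?thesis unfolding Y_def C_def .
  qed
qed

lemma ad_scaled_pow:
  assumes "row_finite C"
  shows "ad C (mscale a (mpow C n)) = mzero"
proof -
  have "C \<odot> mscale a (mpow C n) = mscale a (mpow C (Suc n))"
    by (simp add: mmult_scale_right assms)
  moreover have "mscale a (mpow C n) \<odot> C = mscale a (mpow C (Suc n))"
    unfolding mpow_Suc_right[OF assms] by (intro mmult_scale_left row_finite_pow assms)
  ultimately show ?thesis by (simp add: ad_def mminus_def mzero_def)
qed

theorem proposition4p3:
  fixes \<alpha> :: "nat \<Rightarrow> complex" and \<Omega> :: infmat and n :: nat
  assumes "verblunsky \<alpha>" and "tridiagonal \<Omega>"
  shows "((ad (CMV \<alpha>) ^^ (n + 1)) \<Omega> = mzero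
            \<longleftrightarrow> (\<exists>a. (ad (CMV \<alpha>) ^^ n) \<Omega> = mscale a (mpow (CMV \<alpha>) n)))
       \<and> ((\<exists>a. (ad (CMV \<alpha>) ^^ n) \<Omega> = mscale a (mpow (CMV \<alpha>) n))
            \<longleftrightarrow> (\<exists>a. ad_sub n \<alpha> \<Omega> = mscale a mone))"
proof -
  interpret laurent_basis "CMV \<alpha>" "cmv_vec \<alpha>" by (rule CMV_laurent_basis) fact
  have rf: "row_finite \<Omega>"
    using assms(2) by (intro row_finite_bounded[where f = Suc]) (simp add: tridiagonal_def)
  have "(ad (CMV \<alpha>) ^^ (n + 1)) \<Omega> = mzero"
    if "(ad (CMV \<alpha>) ^^ n) \<Omega> = mscale a (mpow (CMV \<alpha>) n)" for a
    using that by (simp add: ad_scaled_pow row_finite_CMV)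
  moreover have "\<Omega> i j = 0" if "Suc j < i" for i j
    using that assms(2) by (simp add: tridiagonal_def)
  ultimately show ?thesis
    using ad_pow_eq_scaled_pow[OF rf] ad_sub_scalar_iff[OF assms(1) rf] by blast
qed

end
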